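(* Let $q$ be a prime power, let $n\ge 2$ be an integer, and let $\Gamma$ be the singular difference graph of $M_n(\mathbb{F}_q)$. Let $$\mathcal{D}=\{cE_{nj}: c\in\mathbb{F}_q,\ 1\le j\le n\},$$ where $E_{nj}$ denotes the $n\times n$ matrix with $1$ in the $(n,j)$-entry and zeros elsewhere. Then $\mathcal{D}$ is a dominating set of $\Gamma$, and $|\mathcal{D}|=n(q-1)+1$.
   Context: $\mathbb{F}_q$ is the finite field with $q$ elements and $M_n(\mathbb{F}_q)$ is the vector space of all $n\times n$ matrices over $\mathbb{F}_q$. The singular difference graph $\Gamma$ of $M_n(\mathbb{F}_q)$ is the simple graph with vertex set $M_n(\mathbb{F}_q)$ in which two distinct matrices $A,B$ are adjacent if and only if $\det(A-B)=0$. A subset $\mathcal{D}$ of the vertex set $V$ of a graph is a dominating set if every vertex in $V\setminus\mathcal{D}$ is adjacent to at least one vertex of $\mathcal{D}$. *)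

theory Defs
  imports
    "HOL-Number_Theory.Prime_Powers"
    "Graph_Theory.Pair_Digraph"
    "Jordan_Normal_Form.Determinant"
begin

text \<open>
  Simple graphs are, as in the Graph Theory entry, symmetric digraphs without loops or parallel
  arcs (locale \<open>pair_graph\<close>): an edge between \<open>u\<close> and \<open>v\<close> is the pair of
  arcs \<open>(u, v)\<close> and \<open>(v, u)\<close>.
\<close>

definition singular_difference_graph :: "nat \<Rightarrow> 'a :: comm_ring_1 mat pair_pre_digraph" where
  "singular_difference_graph n =
     \<lparr> pverts = carrier_mat n n,
       parcs = {(A, B). A \<in> carrier_mat n n \<and> B \<in> carrier_mat n n \<and> A \<noteq> B \<and> det (A - B) = 0} \<rparr>"

text \<open>
  The library notation \<open>v \<rightarrow>\<^bsub>G\<^esub> d\<close> says that \<open>(v, d)\<close> is an arc of \<open>G\<close>; the notion is only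
  meant for symmetric \<open>G\<close>, where the direction of the arc is irrelevant.
\<close>

definition dominating_set :: "('v, 'e) pre_digraph \<Rightarrow> 'v set \<Rightarrow> bool" where
  "dominating_set G D \<longleftrightarrow> D \<subseteq> verts G \<and> (\<forall>v \<in> verts G - D. \<exists>d \<in> D. v \<rightarrow>\<^bsub>G\<^esub> d)"

text \<open>Rows and columns are numbered from 0, as for all matrices of type \<open>mat\<close>: the matrix
  \<open>E\<^sub>i\<^sub>j\<close> of the usual numbering from 1 is \<open>matrix_unit n (i - 1) (j - 1)\<close>.\<close>

definition matrix_unit :: "nat \<Rightarrow> nat \<Rightarrow> nat \<Rightarrow> 'a :: zero_neq_one mat" where
  "matrix_unit n i j = mat n n (\<lambda>(r, s). if r = i \<and> s = j then 1 else 0)"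

lemma finite_carrier_mat: "finite (carrier_mat n m :: 'a :: finite mat set)"
proof (rule finite_surj)
  show "finite (({..<n} \<times> {..<m}) \<rightarrow>\<^sub>E (UNIV :: 'a set))"
    by (intro finite_PiE) auto
  show "(carrier_mat n m :: 'a mat set) \<subseteq> mat n m ` (({..<n} \<times> {..<m}) \<rightarrow>\<^sub>E UNIV)"
  proof
    fix A :: "'a mat" assume A: "A \<in> carrier_mat n m"
    have "A = mat n m (restrict (\<lambda>ij. A $$ ij) ({..<n} \<times> {..<m}))"
      using A by (intro eq_matI) auto
    moreover have "mat n m (restrict (\<lambda>ij. A $$ ij) ({..<n} \<times> {..<m}))
        \<in> mat n m ` (({..<n} \<times> {..<m}) \<rightarrow>\<^sub>E UNIV)"
      by (rule imageI) (simp add: PiE_iff extensional_def)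
    ultimately show "A \<in> mat n m ` (({..<n} \<times> {..<m}) \<rightarrow>\<^sub>E UNIV)"
      by metis
  qed
qed

lemma pair_graph_singular_difference_graph:
  "pair_graph (singular_difference_graph n :: 'a :: {field, finite} mat pair_pre_digraph)"
proof -
  let ?G = "singular_difference_graph n :: 'a mat pair_pre_digraph"
  have det_swap: "det (B - A) = 0"
    if "A \<in> carrier_mat n n" "B \<in> carrier_mat n n" "det (A - B) = 0" for A B :: "'a mat"
  proof -
    have "B - A = (- 1) \<cdot>\<^sub>m (A - B)"
      using that(1,2) by (intro eq_matI) auto
    then show ?thesis using that(3) by simp
  qed
  have "finite (parcs ?G)"
    by (rule finite_subset[OF _ finite_cartesian_product[OF finite_carrier_mat finite_carrier_mat]])
       (auto simp: singular_difference_graph_def)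
  moreover have "symmetric (with_proj ?G)"
    by (auto simp: symmetric_def sym_def singular_difference_graph_def intro: det_swap)
  moreover have "pverts ?G = carrier_mat n n"
    by (simp add: singular_difference_graph_def)
  moreover have "fst e \<in> carrier_mat n n \<and> snd e \<in> carrier_mat n n \<and> fst e \<noteq> snd e"
    if "e \<in> parcs ?G" for e
    using that unfolding singular_difference_graph_def by auto
  ultimately show ?thesis
    by unfold_locales (simp_all add: finite_carrier_mat)
qed

end

theory Submission
  imports Defs
begin

text \<open>
  Changing a single entry \<open>(i, j)\<close> of a matrix \<open>A\<close> by \<open>-c\<close> leaves the minors along row \<open>i\<close> alone, so
  by Laplace expansion the determinant is affine in \<open>c\<close>, with slope minus the \<open>(i, j)\<close> cofactor of
  \<open>A\<close> (\<open>det_minus_smult_matrix_unit\<close>). If \<open>A\<close> is nonsingular, expansion along row \<open>i\<close> shows that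
  one of these cofactors is nonzero, and over a field the affine function then has a root \<open>c\<close>. If
  \<open>A\<close> is singular, \<open>c = 0\<close> will do. So every matrix has singular difference from some multiple of a
  matrix unit of any prescribed row (\<open>exists_singular_difference\<close>); for the last row this is
  domination, as a matrix outside \<open>D\<close> is distinct from the member of \<open>D\<close> so obtained.

  For the cardinality, nonzero multiples \<open>c E\<close> of matrix units are determined by their scalar
  and position, whereas \<open>c = 0\<close> always gives the zero matrix.
\<close>

lemma matrix_unit_carrier [simp]: "matrix_unit n i j \<in> carrier_mat n n"
  by (simp add: matrix_unit_def)

lemma dim_matrix_unit [simp]:
  "dim_row (matrix_unit n i j) = n" "dim_col (matrix_unit n i j) = n"
  by (simp_all add: matrix_unit_def)

lemma index_matrix_unit [simp]:
  "r < n \<Longrightarrow> s < n \<Longrightarrow> matrix_unit n i j $$ (r, s) = (if r = i \<and> s = j then 1 else 0)"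
  by (simp add: matrix_unit_def)

lemma cofactor_minus_smult_matrix_unit:
  fixes A :: "'a :: comm_ring_1 mat"
  assumes "A \<in> carrier_mat n n" "i < n" "k < n"
  shows "cofactor (A - c \<cdot>\<^sub>m matrix_unit n i j) i k = cofactor A i k"
proof -
  have "mat_delete (A - c \<cdot>\<^sub>m matrix_unit n i j) i k = mat_delete A i k"
    using assms by (intro eq_matI) (auto simp: mat_delete_def matrix_unit_def)
  then show ?thesis by (simp add: cofactor_def)
qed

text \<open>Only the coefficients of the expansion along row \<open>i\<close> change, and only the one in column
  \<open>j\<close>.\<close>

lemma det_minus_smult_matrix_unit:
  fixes A :: "'a :: comm_ring_1 mat"
  assumes A: "A \<in> carrier_mat n n" and i: "i < n" and j: "j < n"
  shows "det (A - c \<cdot>\<^sub>m matrix_unit n i j) = det A - c * cofactor A i j"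
proof -
  let ?B = "A - c \<cdot>\<^sub>m matrix_unit n i j"
  have B: "?B \<in> carrier_mat n n" by (simp add: minus_carrier_mat)
  have "det ?B = (\<Sum>k<n. ?B $$ (i, k) * cofactor ?B i k)"
    by (rule laplace_expansion_row[OF B i])
  also have "\<dots> = (\<Sum>k<n. A $$ (i, k) * cofactor A i k - (if k = j then c * cofactor A i j else 0))"
    using A i by (intro sum.cong)
      (auto simp: cofactor_minus_smult_matrix_unit left_diff_distrib)
  also have "\<dots> = (\<Sum>k<n. A $$ (i, k) * cofactor A i k) - c * cofactor A i j"
    using j by (simp add: sum_subtractf)
  also have "(\<Sum>k<n. A $$ (i, k) * cofactor A i k) = det A"
    by (rule laplace_expansion_row[OF A i, symmetric])
  finally show ?thesis .
qed

lemma exists_singular_difference: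
  fixes A :: "'a :: field mat"
  assumes A: "A \<in> carrier_mat n n" and i: "i < n"
  shows "\<exists>c. \<exists>j<n. det (A - c \<cdot>\<^sub>m matrix_unit n i j) = 0"
proof (cases "det A = 0")
  case True
  then have "det (A - 0 \<cdot>\<^sub>m matrix_unit n i i) = 0"
    using A i by (simp add: det_minus_smult_matrix_unit)
  then show ?thesis using i by blast
next
  case False
  then have "(\<Sum>j<n. A $$ (i, j) * cofactor A i j) \<noteq> 0"
    using laplace_expansion_row[OF A i] by simp
  then obtain j where j: "j < n" and "A $$ (i, j) * cofactor A i j \<noteq> 0"
    by (meson lessThan_iff sum.not_neutral_contains_not_neutral)
  then have "cofactor A i j \<noteq> 0" by simp
  then have "det (A - (det A / cofactor A i j) \<cdot>\<^sub>m matrix_unit n i j) = 0"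
    using A i j by (simp add: det_minus_smult_matrix_unit)
  then show ?thesis using j by blast
qed

lemma inj_on_smult_matrix_unit:
  assumes i: "i < n"
  shows "inj_on (\<lambda>(c, j). c \<cdot>\<^sub>m matrix_unit n i j) ((UNIV - {0 :: 'a :: comm_ring_1}) \<times> {..<n})"
proof (rule inj_onI)
  fix x y
  assume x: "x \<in> (UNIV - {0 :: 'a}) \<times> {..<n}" and "y \<in> (UNIV - {0 :: 'a}) \<times> {..<n}"
    and eq: "(\<lambda>(c, j). c \<cdot>\<^sub>m matrix_unit n i j) x = (\<lambda>(c, j). c \<cdot>\<^sub>m matrix_unit n i j) y"
  obtain c j d k where xy: "x = (c, j)" "y = (d, k)" by (cases x, cases y)
  \<comment> \<open>The entry at \<open>(i, j)\<close> tells both the scalar and the position.\<close>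
  have "(c \<cdot>\<^sub>m matrix_unit n i j) $$ (i, j) = (d \<cdot>\<^sub>m matrix_unit n i k) $$ (i, j)"
    using eq unfolding xy prod.case by (rule arg_cong)
  moreover have "j < n" "c \<noteq> 0" using x xy by auto
  ultimately have "c = (if j = k then d else 0)"
    using i by simp
  with \<open>c \<noteq> 0\<close> show "x = y" using xy by (auto split: if_splits)
qed

lemma card_multiples_of_matrix_units_in_row:
  assumes i: "i < n"
  shows "card {c \<cdot>\<^sub>m matrix_unit n i j | (c :: 'a :: {comm_ring_1, finite}) j. j < n}
    = n * (card (UNIV :: 'a set) - 1) + 1"
proof -
  let ?f = "\<lambda>(c :: 'a, j). c \<cdot>\<^sub>m matrix_unit n i j"
  let ?P = "(UNIV - {0 :: 'a}) \<times> {..<n}"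
  have zero: "0 \<cdot>\<^sub>m matrix_unit n i j = (0\<^sub>m n n :: 'a mat)" for j
    by (intro eq_matI) (auto simp: matrix_unit_def)
  have "{c \<cdot>\<^sub>m matrix_unit n i j | (c :: 'a) j. j < n} = insert (0\<^sub>m n n) (?f ` ?P)"
    (is "?D = ?R")
  proof
    show "?D \<subseteq> ?R"
    proof clarify
      fix c :: 'a and j
      assume "j < n" and "c \<cdot>\<^sub>m matrix_unit n i j \<notin> ?f ` ?P"
      then have "c = 0" by force
      then show "c \<cdot>\<^sub>m matrix_unit n i j = 0\<^sub>m n n" by (simp add: zero)
    qed
    show "?R \<subseteq> ?D"
    proof -
      have "0\<^sub>m n n \<in> ?D" unfolding zero[of i, symmetric] using i by blast
      then show ?thesis by auto
    qed
  qed
  moreover have "0\<^sub>m n n \<notin> ?f ` ?P"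
  proof
    assume "0\<^sub>m n n \<in> ?f ` ?P"
    then obtain c :: 'a and j
      where j: "j < n" and "c \<noteq> 0" and eq: "0\<^sub>m n n = c \<cdot>\<^sub>m matrix_unit n i j"
      by (elim imageE SigmaE) simp
    have "(0\<^sub>m n n :: 'a mat) $$ (i, j) = c"
      unfolding eq using i j by simp
    with i j \<open>c \<noteq> 0\<close> show False by simp
  qed
  moreover have "card (?f ` ?P) = n * (card (UNIV :: 'a set) - 1)"
    using card_image[OF inj_on_smult_matrix_unit[OF i]]
    by (simp only: card_cartesian_product card_Diff_singleton[OF UNIV_I] card_lessThan mult.commute)
  ultimately show ?thesis by simp
qed

theorem theorem4p13:
  fixes q n :: nat
    and D :: "'a :: {field, finite} mat set"
  assumes "primepow q"
    and "card (UNIV :: 'a set) = q"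
    and "n \<ge> 2"
    and "D = {c \<cdot>\<^sub>m matrix_unit n (n - 1) j | c j. j < n}"
  shows "dominating_set (with_proj (singular_difference_graph n)) D \<and> card D = n * (q - 1) + 1"
proof
  have last: "n - 1 < n" using assms(3) by simp
  have D_carrier: "D \<subseteq> carrier_mat n n"
    unfolding assms(4) by auto
  have "\<exists>d\<in>D. A \<noteq> d \<and> det (A - d) = 0" if A: "A \<in> carrier_mat n n" and "A \<notin> D" for A
  proof -
    obtain c j where "j < n" and det: "det (A - c \<cdot>\<^sub>m matrix_unit n (n - 1) j) = 0"
      using exists_singular_difference[OF A last] by blast
    then have "c \<cdot>\<^sub>m matrix_unit n (n - 1) j \<in> D"
      unfolding assms(4) by blast
    with det \<open>A \<notin> D\<close> show ?thesis by metis
  qed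
  then show "dominating_set (with_proj (singular_difference_graph n)) D"
    using D_carrier by (auto simp: dominating_set_def singular_difference_graph_def subset_iff)
  show "card D = n * (q - 1) + 1"
    using card_multiples_of_matrix_units_in_row[OF last, where 'a = 'a] assms(2,4) by simp
qed

end
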